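(* Let $T$ be a triangle with edges $e_1,e_2,e_3$ and let $X_1,\dots,X_n$ be iid uniformly distributed on $T$. For $j=1,2,3$ let $X_{e_j}(n)$ be a point of $\{X_1,\dots,X_n\}$ minimizing the Euclidean distance to the edge $e_j$ (almost surely unique), and let $E_{c,3}(n)$ be the event that $X_{e_1}(n),X_{e_2}(n),X_{e_3}(n)$ are pairwise distinct. Then $P(E_{c,3}(n))\to 1$ as $n\to\infty$.
   Context: $T$ is a closed non-degenerate triangle in $\mathbb{R}^2$; $X_{e_j}(n)$ are called the (closest) edge extrema of the sample. *)

theory Defs
  imports "HOL-Probability.Probability"
begin

definition closed_triangle :: "(3 \<Rightarrow> real^2) \<Rightarrow> (real^2) set" where
  "closed_triangle v = convex hull (range v)"

text \<open>Arithmetic on the index type \<open>3\<close> is modulo 3, so \<open>edge v j\<close> is the side opposite to the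
  vertex \<open>v j\<close>.\<close>

definition edge :: "(3 \<Rightarrow> real^2) \<Rightarrow> 3 \<Rightarrow> (real^2) set" where
  "edge v j = closed_segment (v (j + 1)) (v (j + 2))"

definition is_edge_extremum :: "(3 \<Rightarrow> real^2) \<Rightarrow> 3 \<Rightarrow> (real^2) set \<Rightarrow> real^2 \<Rightarrow> bool" where
  "is_edge_extremum v j S x \<longleftrightarrow> is_arg_min (\<lambda>y. infdist y (edge v j)) (\<lambda>y. y \<in> S) x"

definition E_c3 :: "'w measure \<Rightarrow> (3 \<Rightarrow> nat \<Rightarrow> 'w \<Rightarrow> real^2) \<Rightarrow> nat \<Rightarrow> 'w set" where
  "E_c3 M Xe n = {\<omega> \<in> space M. Xe 1 n \<omega> \<noteq> Xe 2 n \<omega> \<and> Xe 1 n \<omega> \<noteq> Xe 3 n \<omega> \<and> Xe 2 n \<omega> \<noteq> Xe 3 n \<omega>}"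

end

theory Submission
  imports Defs "HOL-Real_Asymp.Real_Asymp"
begin

text \<open>Take \<open>\<epsilon>\<close> of order \<open>n powr (-3/4)\<close>. The points of the triangle at distance more than \<open>\<epsilon>\<close> from
  an edge lie in a copy of the triangle shrunk towards the opposite vertex by a factor \<open>1 - \<epsilon> / L\<close>,
  where \<open>L\<close> is the length of another edge, so with probability tending to 1 some sample point lies
  within \<open>\<epsilon>\<close> of each edge. A common extremum of two edges is then within \<open>\<epsilon>\<close> of both, hence within
  \<open>K \<epsilon>\<close> of their common vertex; the probability that any sample point lies there is at most of order
  \<open>n \<epsilon>\<^sup>2\<close>, which tends to 0.\<close>

section \<open>Geometry of a triangle near its sides\<close>

lemma infdist_attained:
  fixes A :: "'a::heine_borel set"
  assumes "closed A" "A \<noteq> {}"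
  shows "\<exists>p\<in>A. infdist x A = dist x p"
proof -
  obtain p where "p \<in> A" "\<And>y. y \<in> A \<Longrightarrow> dist x p \<le> dist x y"
    using distance_attains_inf[OF assms] by blast
  then have "infdist x A = dist x p"
    unfolding infdist_def using assms(2)
    by (auto intro!: antisym cINF_greatest cINF_lower)
  with \<open>p \<in> A\<close> show ?thesis by blast
qed

text \<open>The directions \<open>b - c\<close> and \<open>a - c\<close> are linearly independent,
  so \<open>f\<close> is injective and hence bounded below by some \<open>B > 0\<close>. The points
  nearest to \<open>x\<close> on the two sides are \<open>c + s (b - c)\<close> and
  \<open>c + t (a - c)\<close>; their difference \<open>f (s, t)\<close> has norm at most
  \<open>2 * e\<close>, which forces \<open>s\<close> to be of order \<open>e\<close>.\<close>

lemma near_both_sides_imp_near_vertex: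
  fixes a b c :: "'a::euclidean_space"
  assumes "\<not> collinear {a, b, c}"
  obtains K where "K > 0"
    "\<And>x e. infdist x (closed_segment b c) \<le> e \<Longrightarrow> infdist x (closed_segment a c) \<le> e
       \<Longrightarrow> dist c x \<le> K * e"
proof -
  define f where "f = (\<lambda>p::real \<times> real. fst p *\<^sub>R (b - c) - snd p *\<^sub>R (a - c))"
  have nc: "\<not> collinear {0, b - c, a - c}"
  proof -
    have "{a, b, c} = {b, c, a}" by auto
    with assms show ?thesis using collinear_3[of b c a] by (simp add: NO_MATCH_def)
  qed
  have lin: "linear f"
    unfolding f_def by (intro linearI) (auto simp: algebra_simps)
  have "inj f"
  proof (subst linear_injective_0[OF lin], intro allI impI)
    fix p assume "f p = 0"
    then have eq: "fst p *\<^sub>R (b - c) = snd p *\<^sub>R (a - c)" by (simp add: f_def)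
    have "snd p = 0"
    proof (rule ccontr)
      assume "snd p \<noteq> 0"
      then have "a - c = (1 / snd p) *\<^sub>R (snd p *\<^sub>R (a - c))" by simp
      then have "a - c = (fst p / snd p) *\<^sub>R (b - c)" by (simp flip: eq)
      with nc show False by (auto simp: collinear_lemma)
    qed
    moreover have "fst p = 0"
      using eq nc \<open>snd p = 0\<close> by (auto simp: collinear_lemma)
    ultimately show "p = 0" by (simp add: prod_eq_iff)
  qed
  then obtain B where B: "B > 0" "\<And>p. B * norm p \<le> norm (f p)"
    using linear_inj_bounded_below_pos[OF lin] by blast
  \<comment> \<open>The summand 1 pays for the distance from \<open>x\<close> to its nearest point
    \<open>p\<close> on the side \<open>b c\<close>, the other summand for the distance from
    \<open>p\<close> to \<open>c\<close>.\<close>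
  define K where "K = 1 + 2 * norm (b - c) / B"
  have "dist c x \<le> K * e"
    if bc: "infdist x (closed_segment b c) \<le> e" and ac: "infdist x (closed_segment a c) \<le> e" for x e
  proof -
    have attained: "\<exists>s. infdist x (closed_segment y c) = dist x (c + s *\<^sub>R (y - c))" for y
    proof -
      obtain p where p: "p \<in> closed_segment c y" "infdist x (closed_segment c y) = dist x p"
        using infdist_attained[OF closed_segment[of c y], of x] by auto
      from p(1) obtain s where "p = (1 - s) *\<^sub>R c + s *\<^sub>R y" by (auto simp: closed_segment_def)
      then have "p = c + s *\<^sub>R (y - c)" by (simp add: algebra_simps)
      with p(2) show ?thesis by (metis closed_segment_commute)
    qed
    obtain s t where "dist x (c + s *\<^sub>R (b - c)) \<le> e" "dist x (c + t *\<^sub>R (a - c)) \<le> e"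
      using attained bc ac by metis
    moreover define p q where "p = c + s *\<^sub>R (b - c)" and "q = c + t *\<^sub>R (a - c)"
    ultimately have p: "dist x p \<le> e" and q: "dist x q \<le> e" by simp_all
    have "B * \<bar>s\<bar> \<le> B * norm (s, t)"
      using B(1) norm_fst_le[of "s" t] by (auto intro!: mult_left_mono)
    also have "\<dots> \<le> norm (f (s, t))" by (rule B)
    also have "f (s, t) = p - q" by (simp add: f_def p_def q_def)
    also have "norm (p - q) \<le> 2 * e"
      using dist_triangle3[of p q x] p q by (simp add: dist_norm)
    finally have "\<bar>s\<bar> \<le> 2 * e / B" using B(1) by (simp add: field_simps)
    then have "\<bar>s\<bar> * norm (b - c) \<le> 2 * e / B * norm (b - c)"
      by (rule mult_right_mono) simp
    moreover have "dist c p = \<bar>s\<bar> * norm (b - c)" by (simp add: p_def dist_norm)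
    moreover have "dist c x \<le> dist c p + dist x p" by (rule dist_triangle2)
    moreover have "K * e = e + 2 * e / B * norm (b - c)" by (simp add: K_def algebra_simps)
    ultimately show ?thesis using p by linarith
  qed
  moreover have "K > 0" using B(1) by (simp add: K_def add_pos_nonneg)
  ultimately show ?thesis by (rule that[rotated])
qed
text \<open>The distance of \<open>x\<close> to the side opposite to \<open>a\<close> is at most
  \<open>dist a b\<close> times the barycentric coordinate \<open>u\<close> of \<open>x\<close> at
  \<open>a\<close>. Being far from that side thus gives \<open>u > d\<close>, which leaves room to
  split off the multiple \<open>d\<close> of \<open>a\<close>. Measuring along the side
  \<open>a b\<close> avoids the height of the triangle.\<close>

lemma far_from_side_in_shrunk_triangle:
  fixes a b c x :: "'a::euclidean_space"
  assumes x: "x \<in> convex hull {a, b, c}"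
    and far: "infdist x (closed_segment b c) > dist a b * d" and d: "0 \<le> d"
  shows "x \<in> (\<lambda>y. (1 - d) *\<^sub>R y + d *\<^sub>R a) ` (convex hull {a, b, c})"
proof -
  from x obtain u v w where x_eq: "x = u *\<^sub>R a + v *\<^sub>R b + w *\<^sub>R c"
    and uvw: "0 \<le> u" "0 \<le> v" "0 \<le> w" "u + v + w = 1"
    unfolding convex_hull_3 by blast
  \<comment> \<open>Moving the weight of \<open>a\<close> onto \<open>b\<close> slides
    \<open>x\<close> parallel to the side \<open>a b\<close> until it meets the side
    \<open>b c\<close>.\<close>
  define y where "y = (u + v) *\<^sub>R b + w *\<^sub>R c"
  have "y \<in> closed_segment b c"
    unfolding closed_segment_def y_def using uvw by (auto intro!: exI[of _ w]) 
  then have "infdist x (closed_segment b c) \<le> dist x y" by (rule infdist_le)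
  also have "x - y = u *\<^sub>R (a - b)"
    by (simp add: x_eq y_def algebra_simps)
  then have "dist x y = dist a b * u" using uvw(1) by (simp add: dist_norm)
  finally have "dist a b * d < dist a b * u" using far by simp
  then have "d < u" by (metis mult_left_mono not_less zero_le_dist)
  then have d1: "d < 1" using uvw by linarith
  \<comment> \<open>Weight \<open>d\<close> is taken away from \<open>a\<close>; dividing by
    \<open>1 - d\<close> makes the weights sum to 1 again.\<close>
  define z where "z = ((u - d) / (1 - d)) *\<^sub>R a + (v / (1 - d)) *\<^sub>R b + (w / (1 - d)) *\<^sub>R c"
  have "(u - d) / (1 - d) + v / (1 - d) + w / (1 - d) = (u - d + v + w) / (1 - d)"
    by (simp add: add_divide_distrib)
  also have "\<dots> = 1" using d1 uvw(4) by simp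
  finally have "z \<in> convex hull {a, b, c}"
    unfolding convex_hull_3 z_def using d1 \<open>d < u\<close> uvw
    by (intro CollectI exI conjI) (auto simp: divide_nonneg_pos)
  moreover have "x = (1 - d) *\<^sub>R z + d *\<^sub>R a"
    using d1 by (simp add: z_def x_eq scaleR_add_right flip: scaleR_add_left)
  ultimately show ?thesis by blast
qed

section \<open>Area estimates for the uniform distribution on a triangle\<close>

lemma emeasure_triangle:
  fixes a b c :: "real^2"
  assumes "\<not> collinear {a, b, c}"
  shows "emeasure lborel (convex hull {a, b, c}) \<noteq> 0" "emeasure lborel (convex hull {a, b, c}) \<noteq> \<infinity>"
    "convex hull {a, b, c} \<in> sets borel"
proof -
  let ?T = "convex hull {a, b, c}"
  have comp: "compact ?T" by (simp add: finite_imp_compact_convex_hull)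
  then show sets: "?T \<in> sets borel" by (simp add: borel_compact)
  show "emeasure lborel ?T \<noteq> \<infinity>"
    using emeasure_compact_finite[OF comp] by simp
  have "a \<noteq> b" "a \<noteq> c" "b \<noteq> c" and ndep: "\<not> affine_dependent {a, b, c}"
    using assms by (auto simp: collinear_3_eq_affine_dependent)
  then have "interior ?T \<noteq> {}"
    by (subst interior_convex_hull_eq_empty) auto
  then have "\<not> negligible ?T" by (simp add: negligible_convex_interior)
  then show "emeasure lborel ?T \<noteq> 0"
    using sets by (simp add: negligible_iff_emeasure0)
qed

text \<open>The part of the triangle far from the side fits into a copy scaled by
  \<open>1 - d\<close>, whose area carries the factor \<open>(1 - d)\<^sup>2\<close>.\<close>

lemma uniform_far_from_side_le:
  fixes a b c :: "real^2"
  assumes "\<not> collinear {a, b, c}" "0 \<le> d" "d \<le> 1"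
  shows "measure (uniform_measure lborel (convex hull {a, b, c}))
           {x. infdist x (closed_segment b c) > dist a b * d} \<le> 1 - d"
proof -
  let ?T = "convex hull {a, b, c}" and ?A = "{x. infdist x (closed_segment b c) > dist a b * d}"
  note T = emeasure_triangle[OF assms(1)]
  have A: "?A \<in> sets borel"
    by (intro borel_open open_Collect_less continuous_intros)
  let ?S = "(\<lambda>y. (1 - d) *\<^sub>R y + d *\<^sub>R a) ` ?T"
  have comp: "compact ?S"
    by (intro compact_continuous_image continuous_intros) (simp add: finite_imp_compact_convex_hull)
  have "measure lborel (?T \<inter> ?A) \<le> measure lborel ?S"
  proof (rule measure_mono_fmeasurable)
    show "?T \<inter> ?A \<subseteq> ?S" 
      using far_from_side_in_shrunk_triangle[of _ a b c d] assms(2) by blast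
    show "?T \<inter> ?A \<in> sets lborel" using T(3) A by simp
    show "?S \<in> fmeasurable lborel" using comp by (rule fmeasurable_compact)
  qed
  also have "\<dots> = (1 - d)\<^sup>2 * measure lborel ?T"
    using measure_lebesgue_affine[of "1 - d" "d *\<^sub>R a" ?T] comp T(3)
    by (simp add: borel_compact)
  \<comment> \<open>One factor \<open>1 - d\<close> is given up: the linear bound still makes the
    n-th powers vanish.\<close>
  also have "\<dots> \<le> (1 - d) * measure lborel ?T"
    using assms(2,3) by (intro mult_right_mono) (simp_all add: power2_eq_square mult_left_le)
  finally have le: "measure lborel (?T \<inter> ?A) \<le> (1 - d) * measure lborel ?T" .
  have "measure lborel ?T > 0"
    using T by (metis emeasure_eq_ennreal_measure ennreal_0 zero_less_measure_iff measure_nonneg order_le_less top_ennreal_def infinity_ennreal_def)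
  then show ?thesis
    using T A le by (simp add: pos_divide_le_eq)
qed

text \<open>The square of \<open>r\<close> is what lets a union bound over n points tend to 0 for
  radii much smaller than the inverse square root of n.\<close>

lemma uniform_cball_le:
  fixes a b c :: "real^2"
  assumes "\<not> collinear {a, b, c}" "0 \<le> r"
  shows "measure (uniform_measure lborel (convex hull {a, b, c})) (cball p r)
           \<le> unit_ball_vol 2 / measure lborel (convex hull {a, b, c}) * r\<^sup>2"
proof -
  let ?T = "convex hull {a, b, c}"
  note T = emeasure_triangle[OF assms(1)]
  have "measure lborel (?T \<inter> cball p r) \<le> measure lborel (cball p r)"
    using T(3) by (intro measure_mono_fmeasurable) (auto intro!: fmeasurable_compact)
  also have "\<dots> = unit_ball_vol 2 * r\<^sup>2"
    using assms(2) by (simp add: content_cball)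
  finally show ?thesis
    using T by (simp add: divide_right_mono)
qed

section \<open>Probability bounds for the sample\<close>

lemma (in prob_space) indep_vars_prob_all_le:
  assumes indep: "indep_vars (\<lambda>_. N) X I" and J: "finite J" "J \<subseteq> I" and A: "A \<in> sets N"
    and p: "\<And>i. i \<in> J \<Longrightarrow> measure (distr M N (X i)) A \<le> p"
  shows "prob {\<omega> \<in> space M. \<forall>i\<in>J. X i \<omega> \<in> A} \<le> p ^ card J"
\<comment> \<open>The empty case is separate because an intersection over no indices is
  \<open>UNIV\<close>, not \<open>space M\<close>, and \<open>indep_setsD\<close> asks for a
  nonempty index set.\<close>
proof (cases "J = {}")
  case True
  then show ?thesis by simp
next
  case False
  have rv: "X i \<in> measurable M N" if "i \<in> J" for i
    using indep J(2) that by (auto simp: indep_vars_def)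
  have "{\<omega> \<in> space M. \<forall>i\<in>J. X i \<omega> \<in> A} = (\<Inter>i\<in>J. X i -` A \<inter> space M)"
    using False by auto
  also have "prob \<dots> = (\<Prod>i\<in>J. prob (X i -` A \<inter> space M))"
    using indep A J False unfolding indep_vars_def2 by (intro indep_setsD[where I = I]) auto
  also have "\<dots> = (\<Prod>i\<in>J. measure (distr M N (X i)) A)"
    using rv A by (simp add: measure_distr)
  also have "\<dots> \<le> (\<Prod>i\<in>J. p)" using p by (intro prod_mono) auto
  finally show ?thesis by simp
qed

lemma (in prob_space) prob_ex_le:
  fixes p :: real
  assumes J: "finite J" and X: "\<And>i. i \<in> J \<Longrightarrow> X i \<in> measurable M N" and A: "A \<in> sets N"
    and p: "\<And>i. i \<in> J \<Longrightarrow> measure (distr M N (X i)) A \<le> p"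
  shows "prob {\<omega> \<in> space M. \<exists>i\<in>J. X i \<omega> \<in> A} \<le> card J * p"
proof -
  have "{\<omega> \<in> space M. \<exists>i\<in>J. X i \<omega> \<in> A} = (\<Union>i\<in>J. X i -` A \<inter> space M)" by auto
  also have "prob \<dots> \<le> (\<Sum>i\<in>J. prob (X i -` A \<inter> space M))"
    using J X A by (intro finite_measure_subadditive_finite) auto
  also have "\<dots> = (\<Sum>i\<in>J. measure (distr M N (X i)) A)"
    using X A by (simp add: measure_distr)
  also have "\<dots> \<le> (\<Sum>i\<in>J. p)" using p by (rule sum_mono)
  finally show ?thesis by simp
qed

text \<open>This treats one pair of sides, with common vertex \<open>c\<close>. Ties do no harm: the
  argument uses only that \<open>Y n \<omega>\<close> and \<open>Z n \<omega>\<close> are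
  minimisers, however they are chosen.\<close>

lemma (in prob_space) prob_common_extremum_tendsto_0:
  fixes a b c :: "real^2" and X :: "nat \<Rightarrow> 'a \<Rightarrow> real^2"
  assumes nc: "\<not> collinear {a, b, c}"
    and indep: "indep_vars (\<lambda>_. borel) X {1..}"
    and unif: "\<And>i. i \<ge> 1 \<Longrightarrow> distr M borel (X i) = uniform_measure lborel (convex hull {a, b, c})"
    and Y: "\<And>n \<omega>. n \<ge> 1 \<Longrightarrow> \<omega> \<in> space M \<Longrightarrow>
      is_arg_min (\<lambda>y. infdist y (closed_segment b c)) (\<lambda>y. y \<in> (\<lambda>i. X i \<omega>) ` {1..n}) (Y n \<omega>)"
    and Z: "\<And>n \<omega>. n \<ge> 1 \<Longrightarrow> \<omega> \<in> space M \<Longrightarrow>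
      is_arg_min (\<lambda>y. infdist y (closed_segment a c)) (\<lambda>y. y \<in> (\<lambda>i. X i \<omega>) ` {1..n}) (Z n \<omega>)"
  shows "(\<lambda>n. prob {\<omega> \<in> space M. Y n \<omega> = Z n \<omega>}) \<longlonglongrightarrow> 0"
proof -
  obtain K where K: "K > 0" "\<And>x e. infdist x (closed_segment b c) \<le> e \<Longrightarrow>
      infdist x (closed_segment a c) \<le> e \<Longrightarrow> dist c x \<le> K * e"
    using near_both_sides_imp_near_vertex[OF nc] by blast
  define C where "C = unit_ball_vol 2 / measure lborel (convex hull {a, b, c}) * (K * dist a b)\<^sup>2"
  \<comment> \<open>Any exponent strictly between -1 and -1/2 would serve: \<open>n * d n\<close>
    must tend to infinity so that \<open>(1 - d n) ^ n\<close> vanishes, while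
    \<open>n * (d n)\<^sup>2\<close> must tend to 0.\<close>
  define d :: "nat \<Rightarrow> real" where "d n = real n powr (-3/4)" for n
  have rv: "X i \<in> borel_measurable M" if "i \<ge> 1" for i
    using indep that by (auto simp: indep_vars_def)
  \<comment> \<open>Exchanging \<open>a\<close> and \<open>b\<close> turns the estimate for the side
    \<open>b c\<close> into the one for \<open>a c\<close>. The factor \<open>dist a b\<close> is
    symmetric, so both sides share the threshold \<open>?e\<close>.\<close>
  have nc': "\<not> collinear {b, a, c}" using nc by (simp add: insert_commute)
  have bound: "prob {\<omega> \<in> space M. Y n \<omega> = Z n \<omega>} \<le> 2 * (1 - d n) ^ n + n * (C * (d n)\<^sup>2)"
    if n: "n \<ge> 1" for n
  proof -
    let ?J = "{1..n}" and ?e = "dist a b * d n"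
    define A where "A = {x. infdist x (closed_segment b c) > ?e}"
    define B where "B = {x. infdist x (closed_segment a c) > ?e}"
    have meas [measurable]: "A \<in> sets borel" "B \<in> sets borel" "cball c (K * ?e) \<in> sets borel"
      unfolding A_def B_def
      by (intro borel_open borel_closed open_Collect_less closed_cball continuous_intros)+
    have rv' [measurable]: "X i \<in> borel_measurable M" if "i \<in> ?J" for i
      using rv that by simp
    have d: "0 \<le> d n" "d n \<le> 1" using n by (auto simp: d_def intro: order_trans[OF powr_mono[of "-(3/4)" 0]])
    define EA where "EA = {\<omega> \<in> space M. \<forall>i\<in>?J. X i \<omega> \<in> A}"
    define EB where "EB = {\<omega> \<in> space M. \<forall>i\<in>?J. X i \<omega> \<in> B}"
    define EC where "EC = {\<omega> \<in> space M. \<exists>i\<in>?J. X i \<omega> \<in> cball c (K * ?e)}"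
    have [measurable]: "EA \<in> events" "EB \<in> events" "EC \<in> events"
      unfolding EA_def EB_def EC_def by measurable
    \<comment> \<open>Outside \<open>EA\<close> and \<open>EB\<close> each side has a sample point
      within \<open>?e\<close>, so a common minimiser is within \<open>?e\<close> of both sides and,
      by the choice of \<open>K\<close>, puts \<omega> into \<open>EC\<close>.\<close>
    have "{\<omega> \<in> space M. Y n \<omega> = Z n \<omega>} \<subseteq> EA \<union> EB \<union> EC"
    proof safe
      fix \<omega> assume \<omega>: "\<omega> \<in> space M" "Y n \<omega> = Z n \<omega>" and "\<omega> \<notin> EC" "\<omega> \<notin> EB"
      from Y[OF n \<omega>(1)] obtain i where i: "i \<in> ?J" "Y n \<omega> = X i \<omega>"
        by (auto simp: is_arg_min_def)
      have minY: "infdist (X i \<omega>) (closed_segment b c) \<le> infdist (X l \<omega>) (closed_segment b c)"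
        if "l \<in> ?J" for l
        using Y[OF n \<omega>(1)] i(2) that by (force simp: is_arg_min_def not_less)
      have minZ: "infdist (X i \<omega>) (closed_segment a c) \<le> infdist (X l \<omega>) (closed_segment a c)"
        if "l \<in> ?J" for l
        using Z[OF n \<omega>(1)] i(2) \<omega>(2) that by (force simp: is_arg_min_def not_less)
      have "infdist (X i \<omega>) (closed_segment a c) \<le> ?e"
        using \<open>\<omega> \<notin> EB\<close> \<omega>(1) minZ by (force simp: EB_def B_def not_less)
      moreover have "\<not> dist c (X i \<omega>) \<le> K * ?e"
        using \<open>\<omega> \<notin> EC\<close> \<omega>(1) i(1) by (auto simp: EC_def)
      ultimately have "infdist (X i \<omega>) (closed_segment b c) > ?e"
        using K(2) not_less by blast
      then show "\<omega> \<in> EA" using minY \<omega>(1) by (force simp: EA_def A_def)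
    qed
    \<comment> \<open>Monotonicity asks for measurability of the larger set only; a nonmeasurable
      set has measure 0 by convention.\<close>
    then have "prob {\<omega> \<in> space M. Y n \<omega> = Z n \<omega>} \<le> prob (EA \<union> EB \<union> EC)"
      by (intro finite_measure_mono) auto
    also have "\<dots> \<le> prob EA + prob EB + prob EC"
      by (intro order_trans[OF measure_Un_le] add_mono order_refl) auto
    also have "prob EA \<le> (1 - d n) ^ card ?J"
      unfolding EA_def
    proof (rule indep_vars_prob_all_le[OF indep])
      fix i assume "i \<in> ?J"
      then show "measure (distr M borel (X i)) A \<le> 1 - d n"
        using unif uniform_far_from_side_le[OF nc d] by (simp add: A_def)
    qed (auto simp: meas)
    also have "prob EB \<le> (1 - d n) ^ card ?J"
      unfolding EB_def
    proof (rule indep_vars_prob_all_le[OF indep])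
      fix i assume "i \<in> ?J"
      then show "measure (distr M borel (X i)) B \<le> 1 - d n"
        using unif uniform_far_from_side_le[OF nc' d]
        by (simp add: B_def dist_commute insert_commute)
    qed (auto simp: meas)
    also have "prob EC \<le> card ?J * (C * (d n)\<^sup>2)"
      unfolding EC_def
    proof (rule prob_ex_le[where N = borel])
      fix i assume "i \<in> ?J"
      then show "measure (distr M borel (X i)) (cball c (K * ?e)) \<le> C * (d n)\<^sup>2"
        using unif uniform_cball_le[OF nc, of "K * ?e" c] K(1) d(1)
        by (simp add: C_def power_mult_distrib mult_ac)
    qed (auto simp: rv)
    finally show ?thesis by simp
  qed
  have "(\<lambda>n. (1 - d n) ^ n) \<longlonglongrightarrow> 0" unfolding d_def by real_asymp
  moreover have "(\<lambda>n. n * (d n)\<^sup>2) \<longlonglongrightarrow> 0" unfolding d_def by real_asymp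
  ultimately have "(\<lambda>n. 2 * (1 - d n) ^ n + C * (n * (d n)\<^sup>2)) \<longlonglongrightarrow> 2 * 0 + C * 0"
    by (intro tendsto_intros)
  then have lim: "(\<lambda>n. 2 * (1 - d n) ^ n + n * (C * (d n)\<^sup>2)) \<longlonglongrightarrow> 0"
    by (simp add: mult_ac)
  show ?thesis
    by (rule real_tendsto_sandwich[OF _ _ tendsto_const lim])
      (auto intro!: eventually_sequentiallyI[of 1] bound)
qed

section \<open>From pairs of sides to edges indexed modulo 3\<close>

text \<open>The index \<open>m\<close> belongs to the vertex shared by the edges opposite to
  \<open>j\<close> and \<open>k\<close>. Equalities of sets are used because the order in which
  \<open>j + 1\<close> and \<open>j + 2\<close> run through \<open>k\<close> and \<open>m\<close>
  depends on the pair.\<close>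

lemma third_index:
  fixes j k :: 3
  assumes "j \<noteq> k"
  obtains m where "UNIV = {j, k, m}" "{j + 1, j + 2} = {k, m}" "{k + 1, k + 2} = {j, m}"
proof -
  have arith: "1 + 1 = (2::3)" "1 + 2 = (3::3)" "2 + 1 = (3::3)" "2 + 2 = (1::3)"
    "3 + 1 = (1::3)" "3 + 2 = (2::3)"
    by simp_all
  consider "j = 1" "k = 2" | "j = 1" "k = 3" | "j = 2" "k = 1"
    | "j = 2" "k = 3" | "j = 3" "k = 1" | "j = 3" "k = 2"
    using exhaust_3[of j] exhaust_3[of k] assms by blast
  then have "\<exists>m. UNIV = {j, k, m} \<and> {j + 1, j + 2} = {k, m} \<and> {k + 1, k + 2} = {j, m}"
  proof cases
    case 1
    then show ?thesis by (intro exI[of _ 3]) (simp only: arith UNIV_3, blast)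
  next
    case 2
    then show ?thesis by (intro exI[of _ 2]) (simp only: arith UNIV_3, blast)
  next
    case 3
    then show ?thesis by (intro exI[of _ 3]) (simp only: arith UNIV_3, blast)
  next
    case 4
    then show ?thesis by (intro exI[of _ 1]) (simp only: arith UNIV_3, blast)
  next
    case 5
    then show ?thesis by (intro exI[of _ 2]) (simp only: arith UNIV_3, blast)
  next
    case 6
    then show ?thesis by (intro exI[of _ 1]) (simp only: arith UNIV_3, blast)
  qed
  with that show thesis by blast
qed

theorem theorem1:
  fixes v :: "3 \<Rightarrow> real^2"
    and M :: "'w measure"
    and X :: "nat \<Rightarrow> 'w \<Rightarrow> real^2"
    and Xe :: "3 \<Rightarrow> nat \<Rightarrow> 'w \<Rightarrow> real^2"
  assumes nondegenerate: "\<not> collinear (range v)"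
    and "prob_space M"
    and indep: "prob_space.indep_vars M (\<lambda>_. borel) X {1..}"
    and uniform: "\<And>i. i \<ge> 1 \<Longrightarrow> distr M borel (X i) = uniform_measure lborel (closed_triangle v)"
    and Xe_measurable: "\<And>j n. n \<ge> 1 \<Longrightarrow> Xe j n \<in> borel_measurable M"
    and Xe_extremum: "\<And>j n \<omega>. n \<ge> 1 \<Longrightarrow> \<omega> \<in> space M \<Longrightarrow>
      is_edge_extremum v j ((\<lambda>i. X i \<omega>) ` {1..n}) (Xe j n \<omega>)"
  shows "(\<lambda>n. measure M (E_c3 M Xe n)) \<longlonglongrightarrow> 1"
proof -
  interpret prob_space M by fact
  define p where "p j k n = prob {\<omega> \<in> space M. Xe j n \<omega> = Xe k n \<omega>}" for j k n
  have p: "p j k \<longlonglongrightarrow> 0" if jk: "j \<noteq> k" for j k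
  proof -
    obtain m where univ: "UNIV = {j, k, m}" and jm: "{j + 1, j + 2} = {k, m}"
      and km: "{k + 1, k + 2} = {j, m}"
      using third_index[OF jk] by blast
    have range: "range v = {v j, v k, v m}" unfolding univ by simp
    \<comment> \<open>A segment is the convex hull of its set of endpoints, so the unordered
      equality \<open>jm\<close> is enough.\<close>
    have ej: "edge v j = closed_segment (v k) (v m)"
      using arg_cong[OF jm, of "\<lambda>I. convex hull (v ` I)"] by (simp add: edge_def segment_convex_hull)
    have ek: "edge v k = closed_segment (v j) (v m)"
      using arg_cong[OF km, of "\<lambda>I. convex hull (v ` I)"] by (simp add: edge_def segment_convex_hull)
    show ?thesis
      unfolding p_def
    proof (rule prob_common_extremum_tendsto_0)
      show "\<not> collinear {v j, v k, v m}" using nondegenerate by (simp add: range)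
      show "distr M borel (X i) = uniform_measure lborel (convex hull {v j, v k, v m})" if "i \<ge> 1" for i
        using uniform[OF that] by (simp add: closed_triangle_def range)
    qed (use indep Xe_extremum[of _ _ j] Xe_extremum[of _ _ k] in
        \<open>auto simp: is_edge_extremum_def ej ek\<close>)
  qed
  \<comment> \<open>The complement of the event is a union of three coincidence events, and
    subadditivity applies. The case \<open>n = 0\<close> is left out, since extrema are prescribed
    only from \<open>n = 1\<close> on.\<close>
  have bound: "1 - (p 1 2 n + p 1 3 n + p 2 3 n) \<le> prob (E_c3 M Xe n)" if n: "n \<ge> 1" for n
  proof -
    have [measurable]: "Xe j n \<in> borel_measurable M" for j using Xe_measurable[OF n] .
    have [measurable]: "E_c3 M Xe n \<in> events" unfolding E_c3_def by measurable
    have "1 - prob (E_c3 M Xe n) = prob (space M - E_c3 M Xe n)" by (simp add: prob_compl)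
    also have "space M - E_c3 M Xe n = {\<omega> \<in> space M. Xe 1 n \<omega> = Xe 2 n \<omega>} \<union>
        {\<omega> \<in> space M. Xe 1 n \<omega> = Xe 3 n \<omega>} \<union> {\<omega> \<in> space M. Xe 2 n \<omega> = Xe 3 n \<omega>}"
      by (auto simp: E_c3_def)
    also have "prob \<dots> \<le> p 1 2 n + p 1 3 n + p 2 3 n"
      unfolding p_def
      by (intro order_trans[OF measure_Un_le] add_mono order_refl) measurable
    finally show ?thesis by simp
  qed
  have "(\<lambda>n. 1 - (p 1 2 n + p 1 3 n + p 2 3 n)) \<longlonglongrightarrow> 1 - (0 + 0 + 0)"
    by (intro tendsto_intros p) auto
  then have lim: "(\<lambda>n. 1 - (p 1 2 n + p 1 3 n + p 2 3 n)) \<longlonglongrightarrow> 1" by simp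
  show ?thesis
    by (rule real_tendsto_sandwich[OF _ _ lim tendsto_const])
      (auto intro!: eventually_sequentiallyI[of 1] bound)
qed

end
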